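(* The class of all multipliers from $H^1(\mathbb{T})$ to $L^2(\mathbb{T})$ is contained in the class of all multipliers from $L\log^{1/2}L(\mathbb{T})$ to $L^2(\mathbb{T})$, i.e. $$\mathcal{M}_{H^1(\mathbb{T})\rightarrow L^2(\mathbb{T})} \subset \mathcal{M}_{L\log^{1/2}L(\mathbb{T})\rightarrow L^2(\mathbb{T})},$$ and the inclusion is proper.
   Context: $\mathbb{T}$ is the one-dimensional torus (circle group), with dual group $\mathbb{Z}$. $H^1(\mathbb{T})$ is the (real) periodic Hardy space: the space of all $f\in L^1(\mathbb{T})$ whose periodic Hilbert transform $H(f)$ (the conjugate function, with Fourier multiplier $-i\,\mathrm{sgn}(n)$) belongs to $L^1(\mathbb{T})$. For $r\ge 0$, $L\log^{r}L(\mathbb{T})$ is the space of measurable $f$ on $\mathbb{T}$ with $\int_{\mathbb{T}}|f|\log^{r}(1+|f|)\,d\theta<\infty$. For a subspace $X\subset L^1(\mathbb{T})$, a bounded sequence $m=(m(n))_{n\in\mathbb{Z}}\in\ell^\infty(\mathbb{Z})$ is called a multiplier from $X$ to $L^2(\mathbb{T})$ if $\sum_{n\in\mathbb{Z}}|m(n)\widehat{f}(n)|^2<\infty$ for every $f\in X$; $\mathcal{M}_{X\rightarrow L^2(\mathbb{T})}$ denotes the class of all such multipliers. *)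

theory Defs
  imports "HOL-Analysis.Analysis"
begin

text \<open>The torus is represented by the fundamental domain \<open>(-\<pi>, \<pi>]\<close> of \<open>\<real> / 2\<pi>\<int>\<close>, with
  (unnormalised) Lebesgue measure. Functions on the torus are functions on \<open>\<real>\<close> whose values
  outside the fundamental domain are irrelevant; they are complex-valued.\<close>

definition torus :: "real measure" where
  "torus = lebesgue_on {-pi<..pi}"

definition L1_torus :: "(real \<Rightarrow> complex) set" where
  "L1_torus = {f. integrable torus f}"

definition fourier_coeff :: "(real \<Rightarrow> complex) \<Rightarrow> int \<Rightarrow> complex" where
  "fourier_coeff f n = (LINT t|torus. f t * cis (- (of_int n * t))) / (2 * pi)"

text \<open>For \<open>f \<in> L\<^sup>1\<close> the conjugate function \<open>H f\<close> is in general only a distribution, the one with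
  Fourier coefficients \<open>- \<i> sgn(n) f^(n)\<close>. The following relation states that this distribution
  is (represented by) the integrable function \<open>g\<close>, which is then unique almost everywhere.\<close>

definition has_hilbert_transform :: "(real \<Rightarrow> complex) \<Rightarrow> (real \<Rightarrow> complex) \<Rightarrow> bool" where
  "has_hilbert_transform f g \<longleftrightarrow> f \<in> L1_torus \<and> g \<in> L1_torus \<and>
     (\<forall>n. fourier_coeff g n = - \<i> * of_int (sgn n) * fourier_coeff f n)"

definition H1_torus :: "(real \<Rightarrow> complex) set" where
  "H1_torus = {f \<in> L1_torus. \<exists>g \<in> L1_torus. has_hilbert_transform f g}"

text \<open>The convention \<open>0 powr 0 = 0\<close> is harmless for \<open>r = 0\<close>, because the logarithm vanishes only
  where \<open>f\<close> does. As the torus has finite measure, all these classes are contained in \<open>L\<^sup>1\<close>.\<close>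

definition L_log_L_torus :: "real \<Rightarrow> (real \<Rightarrow> complex) set" where
  "L_log_L_torus r = {f \<in> borel_measurable torus.
     (\<integral>\<^sup>+ t. ennreal (cmod (f t) * ln (1 + cmod (f t)) powr r) \<partial>torus) < \<infinity>}"

text \<open>Meaningful for \<open>X \<subseteq> L1_torus\<close>.\<close>

definition multipliers_to_L2 :: "(real \<Rightarrow> complex) set \<Rightarrow> (int \<Rightarrow> complex) set" where
  "multipliers_to_L2 X = {m. bounded (range m) \<and>
     (\<forall>f\<in>X. (\<lambda>n. (cmod (m n * fourier_coeff f n))\<^sup>2) summable_on UNIV)}"

end

theory Submission
  imports Defs "HOL-Library.Discrete_Functions"
begin

text \<open>A multiplier \<open>m\<close> from \<open>H\<^sup>1\<close> to \<open>L\<^sup>2\<close> has bounded square sums over the dyadic blocks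
  \<open>2\<^sup>k \<le> \<bar>n\<bar> < 2\<^sup>k\<^sup>+\<^sup>1\<close>: test \<open>m\<close> on analytic polynomials with the modulus of the Fejer kernel and
  sum them up along a subsequence. Conversely, let \<open>m\<close> have bounded square sums over blocks \<open>B k\<close>
  such that no sum of frequencies from distinct blocks vanishes; dyadic blocks of even index
  have this property, and so do those of odd index. If \<open>g k\<close> is a real polynomial with spectrum in
  \<open>B k\<close> and \<open>\<bar>g k\<bar> \<le> \<alpha> k\<close>, then \<open>exp x \<le> x + exp (x\<^sup>2)\<close> and a Riesz product bound the mean of
  \<open>exp (\<Sum>s * g k)\<close> by \<open>exp (s\<^sup>2 * \<Sum>(\<alpha> k)\<^sup>2)\<close>. Hence \<open>\<Sum>g k\<close> is exponentially square integrable, and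
  Young's inequality and duality give the multiplier property on \<open>L log\<^sup>1\<^sup>/\<^sup>2 L\<close>. The inclusion is
  proper because the indicator function of a set of integers with distinct 2-adic valuations is
  covered by the second argument (with blocks \<open>{n, - n}\<close>), while such a set can have arbitrarily
  many elements in one dyadic block.\<close>

section \<open>Integration of continuous functions and characters over the torus\<close>

lemma space_torus [simp]: "space torus = {-pi<..pi}"
  by (simp add: torus_def)

lemma finite_measure_torus: "finite_measure torus"
  unfolding torus_def
  by (intro finite_measure_lebesgue_on bounded_set_imp_lmeasurable) auto

lemma measure_torus: "measure torus (space torus) = 2 * pi"
  by (simp add: torus_def measure_restrict_space)

lemma borel_measurable_torus_continuous:
  fixes f :: "real \<Rightarrow> 'b::euclidean_space"
  assumes "continuous_on UNIV f"
  shows "f \<in> borel_measurable torus"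
  unfolding torus_def
  by (rule continuous_imp_measurable_on_sets_lebesgue)
     (use assms continuous_on_subset in auto)

text \<open>Continuity on the whole line gives a bound on the compact interval from
  \<open>-pi\<close> to \<open>pi\<close>, and the torus has finite measure.\<close>

lemma integrable_torus_continuous:
  fixes f :: "real \<Rightarrow> 'b::euclidean_space"
  assumes "continuous_on UNIV f"
  shows "integrable torus f"
proof -
  have "compact (f ` {-pi..pi})"
    by (rule compact_continuous_image) (use assms continuous_on_subset in auto)
  then obtain B where "\<forall>y\<in>f ` {-pi..pi}. norm y \<le> B"
    using compact_imp_bounded bounded_iff by blast
  then have "AE t in torus. norm (f t) \<le> B"
    by (intro AE_I2) auto
  then show ?thesis
    using finite_measure.integrable_const_bound[OF finite_measure_torus]
      borel_measurable_torus_continuous[OF assms] by blast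
qed

lemma integral_cis_torus:
  "(LINT t|torus. cis (of_int n * t)) = (if n = 0 then 2 * pi else 0)"
proof (cases "n = 0")
  case True
  then show ?thesis
    using measure_torus by (simp add: scaleR_conv_of_real)
next
  case False
  let ?F = "\<lambda>t. cis (of_int n * t) / (\<i> * of_int n)"
  have "((\<lambda>t. cis (of_int n * t)) has_integral ?F pi - ?F (-pi)) {-pi..pi}"
    by (rule fundamental_theorem_of_calculus)
       (use False in \<open>auto intro!: derivative_eq_intros simp: has_vector_derivative_def
          scaleR_conv_of_real mult_ac\<close>)
  moreover have "sin (of_int n * pi) = 0"
    by (auto simp: sin_zero_iff_int2)
  then have "?F pi - ?F (-pi) = 0"
    by (simp add: complex_eq_iff cis.ctr)
  ultimately have "integral {-pi..pi} (\<lambda>t. cis (of_int n * t)) = 0"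
    by (simp add: integral_unique)
  moreover have "integral {-pi<..pi} (\<lambda>t. cis (of_int n * t))
      = integral {-pi..pi} (\<lambda>t. cis (of_int n * t))"
    by (rule integral_spike_set; rule negligible_subset[of "{-pi}"]) auto
  moreover have "integrable torus (\<lambda>t. cis (of_int n * t))"
    by (intro integrable_torus_continuous continuous_intros)
  ultimately show ?thesis
    using False lebesgue_integral_eq_integral[of "{-pi<..pi}" "\<lambda>t. cis (of_int n * t)"]
    by (simp add: torus_def)
qed

section \<open>Dissociated blocks and Riesz products\<close>

text \<open>The function \<open>\<nu>\<close> picks one frequency from each block in
  \<open>S\<close>. Singletons \<open>S\<close> are included, so no block contains 0.\<close>

definition dissociated :: "('i \<Rightarrow> int set) \<Rightarrow> bool" where
  "dissociated B \<longleftrightarrow>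
     (\<forall>S \<nu>. finite S \<and> S \<noteq> {} \<and> (\<forall>k\<in>S. \<nu> k \<in> B k) \<longrightarrow> (\<Sum>k\<in>S. \<nu> k) \<noteq> 0)"

definition trig_poly :: "(int \<Rightarrow> complex) \<Rightarrow> int set \<Rightarrow> real \<Rightarrow> complex" where
  "trig_poly c A t = (\<Sum>n\<in>A. c n * cis (of_int n * t))"

lemma continuous_on_trig_poly [continuous_intros]: "continuous_on X (trig_poly c A)"
  unfolding trig_poly_def by (intro continuous_intros)

lemma prod_cis: "(\<Prod>k\<in>S. cis (f k)) = cis (\<Sum>k\<in>S. f k)"
  by (induction S rule: infinite_finite_induct) (auto simp: cis_mult)

text \<open>Expanding the product gives one character per choice of frequencies in
  \<open>PiE S B\<close>. By dissociation each has nonzero frequency, hence integral 0.\<close>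

lemma integral_prod_trig_poly:
  assumes B: "dissociated B" "\<And>k. finite (B k)" and S: "finite S" "S \<noteq> {}"
  shows "(LINT t|torus. (\<Prod>k\<in>S. trig_poly (c k) (B k) t)) = 0"
proof -
  have "(\<Prod>k\<in>S. trig_poly (c k) (B k) t)
      = (\<Sum>\<nu>\<in>PiE S B. (\<Prod>k\<in>S. c k (\<nu> k)) * cis (of_int (\<Sum>k\<in>S. \<nu> k) * t))" for t
    unfolding trig_poly_def using S B
    by (subst prod_sum_PiE) (auto simp: prod.distrib prod_cis sum_distrib_right)
  moreover have "integrable torus (\<lambda>t. a * cis (of_int n * t))" for n a
    by (intro integrable_torus_continuous continuous_intros)
  moreover have "(\<Sum>k\<in>S. \<nu> k) \<noteq> 0" if "\<nu> \<in> PiE S B" for \<nu>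
    using B(1) S that unfolding dissociated_def by auto
  ultimately show ?thesis
    using S B by (simp add: Bochner_Integration.integral_sum integral_cis_torus del: of_int_sum)
qed

text \<open>Up to \<open>x = 1\<close> even \<open>exp x \<le> 1 + x + x\<^sup>2\<close> holds, and
  the right-hand side is at most \<open>x + exp (x\<^sup>2)\<close>; beyond 1 already
  \<open>x \<le> x\<^sup>2\<close> suffices. The linear term is kept because its products have mean
  0.\<close>

lemma exp_le_add_exp_square: "exp x \<le> x + exp (x\<^sup>2)" for x :: real
proof -
  consider "x < -1" | "-1 \<le> x" "x \<le> 0" | "0 \<le> x" "x \<le> 1" | "1 < x" by linarith
  then show ?thesis
  proof cases
    case 1
    have "0 \<le> (x + 1) * x" using 1 by (simp add: mult_nonpos_nonpos)
    then have "1 \<le> x + (1 + x\<^sup>2)" by (simp add: power2_eq_square algebra_simps)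
    moreover have "exp x \<le> 1" using 1 by simp
    ultimately show ?thesis using exp_ge_add_one_self[of "x\<^sup>2"] by linarith
  next
    case 2
    have "(1 - x) * (1 + x + x\<^sup>2) = 1 - x ^ 3"
      by (simp add: power2_eq_square power3_eq_cube algebra_simps)
    moreover have "x ^ 3 \<le> 0"
      using 2 by (simp add: power3_eq_cube mult_nonpos_nonpos mult_nonneg_nonpos)
    ultimately have *: "1 \<le> (1 - x) * (1 + x + x\<^sup>2)" by linarith
    have "exp x = inverse (exp (-x))" by (simp add: exp_minus)
    also have "\<dots> \<le> inverse (1 - x)"
      using 2 exp_ge_add_one_self[of "-x"] by (intro le_imp_inverse_le) auto
    also have "\<dots> \<le> 1 + x + x\<^sup>2"
      using * 2 by (simp add: field_simps)
    finally show ?thesis using exp_ge_add_one_self[of "x\<^sup>2"] by linarith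
  next
    case 3
    then show ?thesis using exp_bound[of x] exp_ge_add_one_self[of "x\<^sup>2"] by linarith
  next
    case 4
    then have "x \<le> x\<^sup>2" by (simp add: power2_eq_square)
    then have "exp x \<le> exp (x\<^sup>2)" by simp
    then show ?thesis using 4 by linarith
  qed
qed

text \<open>Dissociation makes the Riesz product \<open>\<Prod>(g k + exp ((\<alpha> k)\<^sup>2))\<close> have the same mean as its
  constant term, and it dominates \<open>exp (\<Sum>g k)\<close>.\<close>

lemma exp_moment_dissociated:
  fixes g :: "'i \<Rightarrow> real \<Rightarrow> real"
  assumes B: "dissociated B" "\<And>k. finite (B k)" and K: "finite K"
    and g: "\<And>k t. k \<in> K \<Longrightarrow> complex_of_real (g k t) = trig_poly (c k) (B k) t"
    and bound: "\<And>k t. k \<in> K \<Longrightarrow> \<bar>g k t\<bar> \<le> \<alpha> k"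
  shows "(LINT t|torus. exp (\<Sum>k\<in>K. g k t)) \<le> 2 * pi * exp (\<Sum>k\<in>K. (\<alpha> k)\<^sup>2)"
proof -
  have cont: "continuous_on UNIV (g k)" if "k \<in> K" for k
  proof -
    have "g k = (\<lambda>t. Re (trig_poly (c k) (B k) t))"
      using g[OF that] by (metis Re_complex_of_real)
    then show ?thesis by (simp add: continuous_intros)
  qed
  define w where "w k = exp ((\<alpha> k)\<^sup>2)" for k
  have ptw: "exp (\<Sum>k\<in>K. g k t) \<le> (\<Prod>k\<in>K. g k t + w k)" for t
  proof -
    have "exp (g k t) \<le> g k t + w k" if "k \<in> K" for k
    proof -
      have "(g k t)\<^sup>2 \<le> (\<alpha> k)\<^sup>2"
        using bound[OF that, of t] by (metis abs_ge_zero power2_abs power_mono)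
      then show ?thesis
        using exp_le_add_exp_square[of "g k t"] unfolding w_def
        by (meson add_left_mono exp_le_cancel_iff order_trans)
    qed
    then show ?thesis
      using K by (subst exp_sum) (auto intro: prod_mono)
  qed
  have zero: "(LINT t|torus. (\<Prod>k\<in>S. g k t)) = 0" if "S \<subseteq> K" "S \<noteq> {}" for S
  proof -
    have "complex_of_real (LINT t|torus. (\<Prod>k\<in>S. g k t))
        = (LINT t|torus. complex_of_real (\<Prod>k\<in>S. g k t))"
      by (rule integral_complex_of_real[symmetric])
    also have "\<dots> = (LINT t|torus. (\<Prod>k\<in>S. trig_poly (c k) (B k) t))"
      using that g by (intro Bochner_Integration.integral_cong) (auto intro!: prod.cong)
    also have "\<dots> = 0"
      using B that K finite_subset by (intro integral_prod_trig_poly) auto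
    finally show ?thesis by simp
  qed
  have int: "integrable torus (\<lambda>t. (\<Prod>k\<in>S. g k t) * a)" if "S \<subseteq> K" for S a
    using that cont by (intro integrable_torus_continuous continuous_intros) auto
  have "(LINT t|torus. exp (\<Sum>k\<in>K. g k t)) \<le> (LINT t|torus. (\<Prod>k\<in>K. g k t + w k))"
    using cont ptw by (intro integral_mono integrable_torus_continuous continuous_intros) auto
  also have "\<dots> = (LINT t|torus. (\<Sum>S\<in>Pow K. (\<Prod>k\<in>S. g k t) * (\<Prod>k\<in>K-S. w k)))"
    using K by (simp add: prod_add)
  also have "\<dots> = (\<Sum>S\<in>Pow K. (LINT t|torus. (\<Prod>k\<in>S. g k t) * (\<Prod>k\<in>K-S. w k)))"
    using int by (intro Bochner_Integration.integral_sum) auto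
  also have "\<dots> = (\<Sum>S\<in>Pow K. if S = {} then 2 * pi * (\<Prod>k\<in>K. w k) else 0)"
    using zero measure_torus by (intro sum.cong) auto
  also have "\<dots> = 2 * pi * (\<Prod>k\<in>K. w k)"
    using K by (simp add: sum.delta')
  finally show ?thesis
    using K by (simp add: w_def exp_sum)
qed

section \<open>Subgaussian functions are exponentially square integrable\<close>

text \<open>The constant in the exponent is chosen such that \<open>exp (h\<^sup>2 / 4)\<close> has a uniformly bounded
  integral.\<close>

definition subgaussian_torus :: "(real \<Rightarrow> real) \<Rightarrow> bool" where
  "subgaussian_torus h \<longleftrightarrow> continuous_on UNIV h \<and>
     (\<forall>s. (LINT t|torus. exp (s * h t)) \<le> 2 * pi * exp (s\<^sup>2 / 4))"

text \<open>With \<open>j = \<lfloor>\<bar>x\<bar>\<rfloor>\<close> the \<open>j\<close>-th term alone dominates. This discretises the identity that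
  writes \<open>exp (x\<^sup>2)\<close> as a Gaussian average of exponentials.\<close>

lemma exp_square_le_suminf_exp:
  "ennreal (exp (x\<^sup>2 / 4))
     \<le> (\<Sum>j. ennreal (exp (1/2 - (real j)\<^sup>2 / 2) * (exp (real j * x) + exp (- real j * x))))"
proof -
  let ?u = "\<lambda>j. exp (1/2 - (real j)\<^sup>2 / 2) * (exp (real j * x) + exp (- real j * x))"
  define j where "j = nat \<lfloor>\<bar>x\<bar>\<rfloor>"
  have j: "real j \<le> \<bar>x\<bar>" "\<bar>x\<bar> \<le> real j + 1"
    unfolding j_def by linarith+
  have "x\<^sup>2 \<le> (real j + 1)\<^sup>2"
    using j(2) by (metis abs_ge_zero power2_abs power_mono)
  \<comment> \<open>This is \<open>(j + 1)\<^sup>2 \<le> 2 + 2 * j\<^sup>2\<close>, the source of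
    the factor \<open>exp (1/2)\<close>.\<close>
  moreover have "0 \<le> (real j - 1)\<^sup>2" by simp
  ultimately have "x\<^sup>2 / 4 \<le> 1/2 + (real j)\<^sup>2 / 2"
    by (simp add: power2_eq_square algebra_simps)
  also have "\<dots> \<le> 1/2 - (real j)\<^sup>2 / 2 + real j * \<bar>x\<bar>"
    using mult_left_mono[OF j(1), of "real j"] by (simp add: power2_eq_square)
  finally have "exp (x\<^sup>2 / 4) \<le> exp (1/2 - (real j)\<^sup>2 / 2) * exp (real j * \<bar>x\<bar>)"
    by (simp flip: exp_add)
  also have "\<dots> \<le> ?u j"
    by (intro mult_left_mono) (auto simp: abs_if)
  finally have "ennreal (exp (x\<^sup>2 / 4)) \<le> ennreal (?u j)"
    by (rule ennreal_leI)
  also have "\<dots> \<le> (\<Sum>j. ennreal (?u j))"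
    by (rule order_trans[OF _ sum_le_suminf[of _ "{j}"]])
       (simp_all only: sum.insert sum.empty finite.intros empty_iff not_False_eq_True
          add_0_right order_refl summableI zero_le)
  finally show ?thesis .
qed

text \<open>Integrate the discretised Gaussian average term by term: the weight
  \<open>exp (- j\<^sup>2 / 2)\<close> beats the moment bound \<open>exp (j\<^sup>2 / 4)\<close>,
  leaving a convergent series that does not depend on \<open>h\<close>.\<close>

lemma subgaussian_exp_square:
  obtains C where "C \<ge> 0"
    "\<And>h. subgaussian_torus h \<Longrightarrow> (\<integral>\<^sup>+ t. ennreal (exp ((h t)\<^sup>2 / 4)) \<partial>torus) \<le> ennreal C"
proof -
  define v where "v j = 4 * pi * exp (1/2 - (real j)\<^sup>2 / 4)" for j
  have "summable (\<lambda>j. exp (-1/4 :: real) ^ j)"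
    by (rule summable_geometric) simp
  moreover have "norm (exp (- ((real j)\<^sup>2 / 4))) \<le> exp (-1/4) ^ j" for j
  proof -
    have "real j \<le> (real j)\<^sup>2"
      by (cases j) (auto simp: power2_eq_square)
    then show ?thesis by (simp flip: exp_of_nat_mult)
  qed
  ultimately have "summable (\<lambda>j. exp (- ((real j)\<^sup>2 / 4)))"
    by (rule summable_comparison_test'[where N = 0])
  then have "summable (\<lambda>j. 4 * pi * exp (1/2) * exp (- ((real j)\<^sup>2 / 4)))"
    by (rule summable_mult)
  then have sv: "summable v"
    by (simp add: v_def[abs_def] mult.assoc flip: exp_add)
  show ?thesis
  proof
    show "0 \<le> suminf v"
      using sv by (intro suminf_nonneg) (auto simp: v_def)
    fix h assume h: "subgaussian_torus h"
    then have cont: "continuous_on UNIV h" by (simp add: subgaussian_torus_def)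
    let ?u = "\<lambda>j t. exp (1/2 - (real j)\<^sup>2 / 2) * (exp (real j * h t) + exp (- real j * h t))"
    have int: "integrable torus (\<lambda>t. exp (s * h t))" for s
      by (intro integrable_torus_continuous continuous_intros cont)
    have "(\<integral>\<^sup>+ t. ennreal (exp ((h t)\<^sup>2 / 4)) \<partial>torus) \<le> (\<integral>\<^sup>+ t. (\<Sum>j. ennreal (?u j t)) \<partial>torus)"
      by (intro nn_integral_mono exp_square_le_suminf_exp)
    also have "\<dots> = (\<Sum>j. \<integral>\<^sup>+ t. ennreal (?u j t) \<partial>torus)"
      by (intro nn_integral_suminf measurable_compose[OF _ measurable_ennreal]
           borel_measurable_torus_continuous continuous_intros cont)
    also have "\<dots> \<le> (\<Sum>j. ennreal (v j))"
    proof (intro suminf_le summableI)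
      fix j
      have "(\<integral>\<^sup>+ t. ennreal (?u j t) \<partial>torus) = ennreal (LINT t|torus. ?u j t)"
        by (intro nn_integral_eq_integral integrable_torus_continuous continuous_intros cont)
           (auto simp: add_nonneg_nonneg)
      also have "(LINT t|torus. ?u j t) = exp (1/2 - (real j)\<^sup>2 / 2)
          * ((LINT t|torus. exp (real j * h t)) + (LINT t|torus. exp (- real j * h t)))"
        using int[of "real j"] int[of "- real j"] by simp
      also have "\<dots> \<le> exp (1/2 - (real j)\<^sup>2 / 2)
          * (2 * pi * exp ((real j)\<^sup>2 / 4) + 2 * pi * exp ((- real j)\<^sup>2 / 4))"
        using h unfolding subgaussian_torus_def
        by (intro mult_left_mono add_mono) (blast, blast, simp)
      also have "\<dots> = v j"
        unfolding v_def by (simp add: mult_ac flip: exp_add)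
      finally show "(\<integral>\<^sup>+ t. ennreal (?u j t) \<partial>torus) \<le> ennreal (v j)"
        by (simp add: ennreal_leI)
    qed
    also have "\<dots> = ennreal (suminf v)"
      by (intro suminf_ennreal2[OF _ sv]) (simp add: v_def)
    finally show "(\<integral>\<^sup>+ t. ennreal (exp ((h t)\<^sup>2 / 4)) \<partial>torus) \<le> ennreal (suminf v)" .
  qed
qed

section \<open>Young's inequality and duality with L log^{1/2} L\<close>

text \<open>A Young inequality with threshold \<open>exp (x\<^sup>2 / 8)\<close>. Below it,
  \<open>u\<close> and \<open>\<bar>x\<bar>\<close> each cost at most a multiple of the square root
  of \<open>exp (x\<^sup>2 / 4)\<close>; above it, \<open>x\<^sup>2\<close> is at most
  \<open>8 * ln (1 + u)\<close>, where 8 is rounded up to the square 9.\<close>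

lemma mult_le_log_exp_square:
  fixes u x :: real
  assumes "u \<ge> 0"
  shows "u * \<bar>x\<bar> \<le> 3 * (u * sqrt (ln (1 + u)) + exp (x\<^sup>2 / 4))"
proof (cases "u \<le> exp (x\<^sup>2 / 8)")
  case True
  have "0 \<le> (\<bar>x\<bar> - 2)\<^sup>2" by simp
  then have "\<bar>x\<bar> \<le> 3 * (1 + x\<^sup>2 / 8)"
    using zero_le_power2[of x] by (simp add: power2_diff)
  also have "\<dots> \<le> 3 * exp (x\<^sup>2 / 8)"
    by (intro mult_left_mono exp_ge_add_one_self) auto
  finally have "u * \<bar>x\<bar> \<le> exp (x\<^sup>2 / 8) * (3 * exp (x\<^sup>2 / 8))"
    using True assms by (intro mult_mono) auto
  also have "\<dots> = 3 * exp (x\<^sup>2 / 4)"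
    by (simp flip: exp_add)
  finally have "u * \<bar>x\<bar> \<le> 3 * exp (x\<^sup>2 / 4)" .
  moreover have "0 \<le> u * sqrt (ln (1 + u))"
    using assms by simp
  ultimately show ?thesis by simp
next
  case False
  then have "x\<^sup>2 / 8 \<le> ln (1 + u)"
    using assms by (subst ln_ge_iff) auto
  then have "x\<^sup>2 \<le> 3\<^sup>2 * ln (1 + u)"
    using ln_ge_zero[of "1 + u"] assms unfolding power2_eq_square by linarith
  then have "\<bar>x\<bar> \<le> sqrt (3\<^sup>2 * ln (1 + u))"
    by (metis real_sqrt_abs real_sqrt_le_mono)
  also have "\<dots> = 3 * sqrt (ln (1 + u))"
    by (simp add: real_sqrt_mult)
  finally have "u * \<bar>x\<bar> \<le> u * (3 * sqrt (ln (1 + u)))"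
    using assms by (intro mult_left_mono)
  also have "\<dots> \<le> 3 * (u * sqrt (ln (1 + u)) + exp (x\<^sup>2 / 4))"
    by simp
  finally show ?thesis .
qed

lemma L_log_L_half_nn_integral:
  assumes "f \<in> L_log_L_torus (1/2)"
  shows "(\<integral>\<^sup>+ t. ennreal (cmod (f t) * sqrt (ln (1 + cmod (f t)))) \<partial>torus) < \<infinity>"
  using assms by (simp add: L_log_L_torus_def powr_half_sqrt)

lemma L_log_L_half_L1:
  assumes "f \<in> L_log_L_torus (1/2)"
  shows "integrable torus f"
proof (rule integrableI_bounded)
  show "f \<in> borel_measurable torus"
    using assms by (simp add: L_log_L_torus_def)
  then have [measurable]: "(\<lambda>t. cmod (f t)) \<in> borel_measurable torus"
    by measurable
  \<comment> \<open>Above 2, \<open>1 + u\<close> exceeds 3 and hence e, so the logarithm is at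
    least 1.\<close>
  have le: "u \<le> 2 + u * sqrt (ln (1 + u))" if "u \<ge> 0" for u :: real
  proof (cases "u \<le> 2")
    case False
    then have "1 \<le> ln (1 + u)"
      using exp_le by (subst ln_ge_iff) auto
    then have "u * 1 \<le> u * sqrt (ln (1 + u))"
      using that by (intro mult_left_mono) auto
    then show ?thesis by simp
  next
    case True
    have "0 \<le> u * sqrt (ln (1 + u))" using that by simp
    then show ?thesis using True by linarith
  qed
  have "(\<integral>\<^sup>+ t. ennreal (cmod (f t)) \<partial>torus)
      \<le> (\<integral>\<^sup>+ t. 2 + ennreal (cmod (f t) * sqrt (ln (1 + cmod (f t)))) \<partial>torus)"
  proof (rule nn_integral_mono)
    fix t
    let ?u = "cmod (f t)"
    have "ennreal ?u \<le> ennreal (2 + ?u * sqrt (ln (1 + ?u)))"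
      by (intro ennreal_leI le) simp
    then show "ennreal ?u \<le> 2 + ennreal (?u * sqrt (ln (1 + ?u)))"
      by (subst (asm) ennreal_plus) auto
  qed
  also have "\<dots> = 2 * emeasure torus (space torus)
      + (\<integral>\<^sup>+ t. ennreal (cmod (f t) * sqrt (ln (1 + cmod (f t)))) \<partial>torus)"
    by (subst nn_integral_add) auto
  also have "\<dots> < \<infinity>"
    using L_log_L_half_nn_integral[OF assms]
      finite_measure.emeasure_finite[OF finite_measure_torus, of "space torus"]
    by (auto simp: ennreal_mult_less_top less_top)
  finally show "(\<integral>\<^sup>+ t. ennreal (cmod (f t)) \<partial>torus) < \<infinity>" .
qed

lemma integrable_mult_continuous_torus:
  fixes f g :: "real \<Rightarrow> 'a::{euclidean_space,real_normed_field}"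
  assumes f: "integrable torus f" and g: "continuous_on UNIV g"
  shows "integrable torus (\<lambda>t. f t * g t)"
proof -
  have "compact (g ` {-pi..pi})"
    by (rule compact_continuous_image) (use g continuous_on_subset in auto)
  then obtain B where B: "\<forall>y\<in>g ` {-pi..pi}. norm y \<le> B"
    using compact_imp_bounded bounded_iff by blast
  show ?thesis
  proof (rule Bochner_Integration.integrable_bound)
    show "integrable torus (\<lambda>t. of_real B * f t)"
      using f by simp
    show "(\<lambda>t. f t * g t) \<in> borel_measurable torus"
      using f borel_measurable_torus_continuous[OF g] by (intro borel_measurable_times) auto
    show "AE t in torus. norm (f t * g t) \<le> norm (of_real B * f t)"
    proof (rule AE_I2)
      fix t assume "t \<in> space torus"
      then have "norm (g t) \<le> B" using B by simp
      then have "norm (g t) \<le> \<bar>B\<bar>" by linarith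
      then show "norm (f t * g t) \<le> norm (of_real B * f t)"
        by (simp add: norm_mult mult.commute[of "\<bar>B\<bar>"] mult_left_mono)
    qed
  qed
qed

text \<open>Integrating Young's inequality bounds the pairing by one integral that depends only on
  \<open>f\<close> and one that is uniform over all subgaussian \<open>h\<close>.\<close>

lemma L_log_L_subgaussian_pairing:
  assumes f: "f \<in> L_log_L_torus (1/2)"
  obtains C where "C \<ge> 0"
    "\<And>h. subgaussian_torus h \<Longrightarrow> (LINT t|torus. cmod (f t) * \<bar>h t\<bar>) \<le> C"
proof -
  obtain C1 where C1: "C1 \<ge> 0"
    "\<And>h. subgaussian_torus h \<Longrightarrow> (\<integral>\<^sup>+ t. ennreal (exp ((h t)\<^sup>2 / 4)) \<partial>torus) \<le> ennreal C1"
    using subgaussian_exp_square by blast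
  have [measurable]: "(\<lambda>t. cmod (f t)) \<in> borel_measurable torus"
    using borel_measurable_integrable[OF L_log_L_half_L1[OF f]] by measurable
  let ?F = "\<lambda>t. cmod (f t) * sqrt (ln (1 + cmod (f t)))"
  obtain C2 where C2: "C2 \<ge> 0" "(\<integral>\<^sup>+ t. ennreal (?F t) \<partial>torus) = ennreal C2"
    using L_log_L_half_nn_integral[OF f] by (auto simp: less_top_ennreal)
  show ?thesis
  proof
    show "0 \<le> 3 * (C2 + C1)" using C1(1) C2(1) by simp
    fix h assume h: "subgaussian_torus h"
    then have cont: "continuous_on UNIV h" by (simp add: subgaussian_torus_def)
    have [measurable]: "h \<in> borel_measurable torus"
      by (rule borel_measurable_torus_continuous[OF cont])
    have int: "integrable torus (\<lambda>t. cmod (f t) * \<bar>h t\<bar>)"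
      using L_log_L_half_L1[OF f]
      by (intro integrable_mult_continuous_torus continuous_intros cont) auto
    have "ennreal (LINT t|torus. cmod (f t) * \<bar>h t\<bar>) = (\<integral>\<^sup>+ t. ennreal (cmod (f t) * \<bar>h t\<bar>) \<partial>torus)"
      by (rule nn_integral_eq_integral[symmetric, OF int]) auto
    also have "\<dots> \<le> (\<integral>\<^sup>+ t. ennreal 3 * (ennreal (?F t) + ennreal (exp ((h t)\<^sup>2 / 4))) \<partial>torus)"
    proof (rule nn_integral_mono)
      fix t
      have "ennreal (cmod (f t) * \<bar>h t\<bar>) \<le> ennreal (3 * (?F t + exp ((h t)\<^sup>2 / 4)))"
        by (intro ennreal_leI mult_le_log_exp_square) simp
      then show "ennreal (cmod (f t) * \<bar>h t\<bar>)
          \<le> ennreal 3 * (ennreal (?F t) + ennreal (exp ((h t)\<^sup>2 / 4)))"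
        by (simp add: ennreal_mult' ennreal_plus distrib_left del: ennreal_numeral)
    qed
    also have "\<dots> = ennreal 3 * ((\<integral>\<^sup>+ t. ennreal (?F t) \<partial>torus) + (\<integral>\<^sup>+ t. ennreal (exp ((h t)\<^sup>2 / 4)) \<partial>torus))"
      by (subst nn_integral_cmult, measurable) (subst nn_integral_add, auto)
    also have "\<dots> \<le> ennreal 3 * (ennreal C2 + ennreal C1)"
      using C1(2)[OF h] unfolding C2(2) by (intro mult_left_mono add_left_mono) auto
    also have "\<dots> = ennreal (3 * (C2 + C1))"
      using C1(1) C2(1) by (simp add: ennreal_mult' ennreal_plus distrib_left del: ennreal_numeral)
    finally show "(LINT t|torus. cmod (f t) * \<bar>h t\<bar>) \<le> 3 * (C2 + C1)"
      using C1(1) C2(1) by (subst (asm) ennreal_le_iff) auto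
  qed
qed

lemma fourier_coeff_pairing:
  assumes f: "integrable torus f"
  shows "(LINT t|torus. f t * (\<Sum>n\<in>A. a n * cis (- (of_int n * t))))
           = 2 * pi * (\<Sum>n\<in>A. a n * fourier_coeff f n)"
proof -
  have "integrable torus (\<lambda>t. f t * cis (- (of_int n * t)))" for n
    by (intro integrable_mult_continuous_torus f continuous_intros)
  then have "integrable torus (\<lambda>t. a n * (f t * cis (- (of_int n * t))))" for n
    by (intro integrable_mult_right)
  then have "(LINT t|torus. (\<Sum>n\<in>A. a n * (f t * cis (- (of_int n * t)))))
      = (\<Sum>n\<in>A. a n * (LINT t|torus. f t * cis (- (of_int n * t))))"
    by (subst Bochner_Integration.integral_sum) auto
  then show ?thesis
    by (simp add: fourier_coeff_def sum_distrib_left mult_ac)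
qed

section \<open>Multipliers with bounded square sums over dissociated blocks\<close>

text \<open>The Riesz product needs real factors. For a symmetric spectrum, taking real parts adds
  no new frequencies.\<close>

lemma Re_trig_poly_symmetric:
  assumes "uminus ` A = A"
  shows "complex_of_real (Re (\<Sum>n\<in>A. a n * cis (- (of_int n * t))))
           = trig_poly (\<lambda>n. (a (- n) + cnj (a n)) / 2) A t"
proof -
  define X where "X = (\<Sum>n\<in>A. a n * cis (- (of_int n * t)))"
  have "X = (\<Sum>n\<in>uminus ` A. a (- n) * cis (of_int n * t))"
    unfolding X_def by (subst sum.reindex) auto
  moreover have "cnj X = (\<Sum>n\<in>A. cnj (a n) * cis (of_int n * t))"
    unfolding X_def by (simp add: cis_cnj)
  ultimately have "X + cnj X = (\<Sum>n\<in>A. (a (- n) + cnj (a n)) * cis (of_int n * t))"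
    using assms by (simp add: sum.distrib algebra_simps)
  also have "\<dots> = 2 * trig_poly (\<lambda>n. (a (- n) + cnj (a n)) / 2) A t"
    by (simp add: trig_poly_def sum_distrib_left)
  finally show ?thesis
    unfolding complex_add_cnj X_def by simp
qed

text \<open>Each block of \<open>s\<close> times the polynomial is bounded by
  \<open>\<bar>s\<bar>\<close> times its coefficient sum. The bound 1/4 on the sum of squares turns
  the Riesz product estimate into the moment bound \<open>exp (s\<^sup>2 / 4)\<close>.\<close>

lemma subgaussian_dissociated:
  assumes B: "dissociated B" "\<And>k. finite (B k)" "\<And>k. uminus ` B k = B k"
    and K: "finite K" and le: "(\<Sum>k\<in>K. (\<Sum>n\<in>B k. norm (a n))\<^sup>2) \<le> 1 / 4"
  shows "subgaussian_torus (\<lambda>t. Re (\<Sum>k\<in>K. \<Sum>n\<in>B k. a n * cis (- (of_int n * t))))"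
proof -
  let ?G = "\<lambda>b k t. \<Sum>n\<in>B k. b n * cis (- (of_int n * t))"
  define \<alpha> where "\<alpha> k = (\<Sum>n\<in>B k. norm (a n))" for k
  have bound: "\<bar>Re (?G (\<lambda>n. of_real s * a n) k t)\<bar> \<le> \<bar>s\<bar> * \<alpha> k" for s k t
  proof -
    have "\<bar>Re (?G (\<lambda>n. of_real s * a n) k t)\<bar> \<le> norm (?G (\<lambda>n. of_real s * a n) k t)"
      by (rule abs_Re_le_cmod)
    also have "\<dots> \<le> (\<Sum>n\<in>B k. \<bar>s\<bar> * norm (a n))"
      by (rule sum_norm_le) (simp add: norm_mult)
    finally show ?thesis by (simp add: \<alpha>_def sum_distrib_left)
  qed
  have "(LINT t|torus. exp (s * Re (\<Sum>k\<in>K. ?G a k t))) \<le> 2 * pi * exp (s\<^sup>2 / 4)" for s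
  proof -
    have "(LINT t|torus. exp (s * Re (\<Sum>k\<in>K. ?G a k t)))
        = (LINT t|torus. exp (\<Sum>k\<in>K. Re (?G (\<lambda>n. of_real s * a n) k t)))"
      by (simp add: sum_distrib_left mult.assoc)
    also have "\<dots> \<le> 2 * pi * exp (\<Sum>k\<in>K. (\<bar>s\<bar> * \<alpha> k)\<^sup>2)"
      by (rule exp_moment_dissociated[OF B(1,2) K Re_trig_poly_symmetric[OF B(3)] bound])
    also have "(\<Sum>k\<in>K. (\<bar>s\<bar> * \<alpha> k)\<^sup>2) = s\<^sup>2 * (\<Sum>k\<in>K. (\<alpha> k)\<^sup>2)"
      by (simp add: power_mult_distrib sum_distrib_left)
    also have "2 * pi * exp (s\<^sup>2 * (\<Sum>k\<in>K. (\<alpha> k)\<^sup>2)) \<le> 2 * pi * exp (s\<^sup>2 * (1 / 4))"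
      using le unfolding \<alpha>_def by (intro mult_left_mono iffD2[OF exp_le_cancel_iff]) auto
    finally show ?thesis by simp
  qed
  moreover have "continuous_on UNIV (\<lambda>t. Re (\<Sum>k\<in>K. ?G a k t))"
    by (intro continuous_intros)
  ultimately show ?thesis
    unfolding subgaussian_torus_def by blast
qed

text \<open>Real and imaginary part of the test polynomial are both subgaussian: multiplying the
  coefficients by \<open>- \<i>\<close> turns the imaginary part into a real part and preserves all
  norms. The bound depends on \<open>f\<close> and \<open>B\<close> only.\<close>

lemma L_log_L_dissociated_pairing:
  assumes B: "dissociated B" "\<And>k. finite (B k)" "\<And>k. uminus ` B k = B k"
    and f: "f \<in> L_log_L_torus (1/2)"
  obtains C where "C \<ge> 0"
    "\<And>K a. finite K \<Longrightarrow> (\<Sum>k\<in>K. (\<Sum>n\<in>B k. norm (a n))\<^sup>2) \<le> 1 / 4 \<Longrightarrow>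
       norm (\<Sum>k\<in>K. \<Sum>n\<in>B k. a n * fourier_coeff f n) \<le> C"
proof -
  obtain C where C: "C \<ge> 0"
    "\<And>h. subgaussian_torus h \<Longrightarrow> (LINT t|torus. cmod (f t) * \<bar>h t\<bar>) \<le> C"
    using L_log_L_subgaussian_pairing[OF f] by blast
  note int = L_log_L_half_L1[OF f]
  have "norm (\<Sum>k\<in>K. \<Sum>n\<in>B k. a n * fourier_coeff f n) \<le> 2 * C"
    if K: "finite K" and le: "(\<Sum>k\<in>K. (\<Sum>n\<in>B k. norm (a n))\<^sup>2) \<le> 1 / 4" for K a
  proof -
    let ?G = "\<lambda>a t. \<Sum>k\<in>K. \<Sum>n\<in>B k. a n * cis (- (of_int n * t))"
    have cont: "continuous_on UNIV (?G a)" for a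
      by (intro continuous_intros)
    have ig: "integrable torus (\<lambda>t. cmod (f t) * \<bar>Re (?G a t)\<bar>)" for a
      using int by (intro integrable_mult_continuous_torus continuous_intros) auto
    have sg: "subgaussian_torus (\<lambda>t. Re (?G a t))"
             "subgaussian_torus (\<lambda>t. Re (?G (\<lambda>n. - \<i> * a n) t))"
      using le by (intro subgaussian_dissociated[OF B K]; simp add: norm_mult)+
    have Im: "Re (?G (\<lambda>n. - \<i> * a n) t) = Im (?G a t)" for t
      by (simp add: sum_negf algebra_simps flip: sum_distrib_left)
    have "(LINT t|torus. f t * ?G a t)
        = (\<Sum>k\<in>K. (LINT t|torus. f t * (\<Sum>n\<in>B k. a n * cis (- (of_int n * t)))))"
      unfolding sum_distrib_left[of _ _ K]
      by (intro Bochner_Integration.integral_sum integrable_mult_continuous_torus int continuous_intros)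
    also have "\<dots> = 2 * pi * (\<Sum>k\<in>K. \<Sum>n\<in>B k. a n * fourier_coeff f n)"
      by (simp only: fourier_coeff_pairing[OF int] sum_distrib_left[of _ _ K])
    finally have "2 * pi * norm (\<Sum>k\<in>K. \<Sum>n\<in>B k. a n * fourier_coeff f n)
        = norm (LINT t|torus. f t * ?G a t)"
      by (simp add: norm_mult)
    also have "\<dots> \<le> (LINT t|torus. norm (f t * ?G a t))"
      by (rule integral_norm_bound)
    also have "\<dots> \<le> (LINT t|torus. cmod (f t) * \<bar>Re (?G a t)\<bar> + cmod (f t) * \<bar>Im (?G a t)\<bar>)"
    proof (rule integral_mono)
      show "integrable torus (\<lambda>t. norm (f t * ?G a t))"
        by (intro integrable_norm integrable_mult_continuous_torus int cont)
      show "integrable torus (\<lambda>t. cmod (f t) * \<bar>Re (?G a t)\<bar> + cmod (f t) * \<bar>Im (?G a t)\<bar>)"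
        using ig[of a] ig[of "\<lambda>n. - \<i> * a n"] unfolding Im by (rule Bochner_Integration.integrable_add)
      show "norm (f t * ?G a t) \<le> cmod (f t) * \<bar>Re (?G a t)\<bar> + cmod (f t) * \<bar>Im (?G a t)\<bar>" for t
        unfolding norm_mult distrib_left[symmetric]
        by (intro mult_left_mono cmod_le) simp
    qed
    also have "\<dots> = (LINT t|torus. cmod (f t) * \<bar>Re (?G a t)\<bar>) + (LINT t|torus. cmod (f t) * \<bar>Im (?G a t)\<bar>)"
      using ig[of a] ig[of "\<lambda>n. - \<i> * a n"] unfolding Im by (rule Bochner_Integration.integral_add)
    also have "\<dots> \<le> C + C"
      using C(2)[OF sg(1)] C(2)[OF sg(2)] unfolding Im by (rule add_mono)
    finally have "2 * pi * norm (\<Sum>k\<in>K. \<Sum>n\<in>B k. a n * fourier_coeff f n) \<le> 2 * C" by simp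
    moreover have "1 * norm (\<Sum>k\<in>K. \<Sum>n\<in>B k. a n * fourier_coeff f n)
        \<le> 2 * pi * norm (\<Sum>k\<in>K. \<Sum>n\<in>B k. a n * fourier_coeff f n)"
      using pi_ge_two by (intro mult_right_mono) auto
    ultimately show ?thesis by linarith
  qed
  with C(1) show ?thesis by (intro that[of "2 * C"]) auto
qed

text \<open>A common element \<open>n\<close>, taken from one block, and \<open>- n\<close>, taken
  from the other, would sum to 0.\<close>

lemma dissociated_disjoint:
  assumes "dissociated B" "\<And>k. uminus ` B k = B k" "k \<noteq> l"
  shows "B k \<inter> B l = {}"
proof (rule ccontr)
  assume "B k \<inter> B l \<noteq> {}"
  then obtain n where n: "n \<in> B k" "- n \<in> B l"
    using assms(2)[of l] by blast
  let ?\<nu> = "\<lambda>j. if j = k then n else - n"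
  have "finite {k, l} \<and> {k, l} \<noteq> {} \<and> (\<forall>j\<in>{k, l}. ?\<nu> j \<in> B j)"
    using assms(3) n by auto
  then have "sum ?\<nu> {k, l} \<noteq> 0"
    using assms(1) unfolding dissociated_def by (elim allE impE)
  then show False using assms(3) by simp
qed

text \<open>The dual form of Zygmund's inequality: test \<open>f\<close> against the polynomial with coefficients
  \<open>\<bar>m n\<bar>\<^sup>2\<close> times the conjugate of the \<open>n\<close>-th coefficient of \<open>f\<close>, normalised by
  Cauchy-Schwarz on each block.\<close>

lemma dissociated_multiplier:
  assumes B: "dissociated B" "\<And>k. finite (B k)" "\<And>k. uminus ` B k = B k"
    and m: "\<And>k. (\<Sum>n\<in>B k. (cmod (m n))\<^sup>2) \<le> M"
    and f: "f \<in> L_log_L_torus (1/2)"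
  shows "(\<lambda>n. (cmod (m n * fourier_coeff f n))\<^sup>2) summable_on (\<Union>k. B k)"
proof -
  obtain C where C: "C \<ge> 0"
    "\<And>K a. finite K \<Longrightarrow> (\<Sum>k\<in>K. (\<Sum>n\<in>B k. norm (a n))\<^sup>2) \<le> 1 / 4 \<Longrightarrow>
       norm (\<Sum>k\<in>K. \<Sum>n\<in>B k. a n * fourier_coeff f n) \<le> C"
    using L_log_L_dissociated_pairing[OF B f] by blast
  define s where "s n = m n * fourier_coeff f n" for n
  \<comment> \<open>The maximum with 1 makes \<open>N\<close> positive, as the normalisation below
    divides by it.\<close>
  define N where "N = max M 1"
  have N: "N > 0" "\<And>k. (\<Sum>n\<in>B k. (cmod (m n))\<^sup>2) \<le> N"
    using m unfolding N_def by (auto intro: order_trans simp: le_max_iff_disj)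
  have T: "(\<Sum>k\<in>K. \<Sum>n\<in>B k. (cmod (s n))\<^sup>2) \<le> 4 * C\<^sup>2 * N" if K: "finite K" for K
  proof -
    define T where "T = (\<Sum>k\<in>K. \<Sum>n\<in>B k. (cmod (s n))\<^sup>2)"
    have "T \<ge> 0" unfolding T_def by (intro sum_nonneg) auto
    show ?thesis
    proof (cases "T = 0")
      case True
      then show ?thesis using N C unfolding T_def by simp
    next
      case False
      with \<open>T \<ge> 0\<close> have "T > 0" by simp
      \<comment> \<open>With this \<open>r\<close> the Cauchy-Schwarz bound
        \<open>r\<^sup>2 * (N * T)\<close> is exactly the admissible 1/4.\<close>
      define r where "r = 1 / (2 * sqrt (N * T))"
      have r: "r > 0" "r\<^sup>2 * (N * T) = 1 / 4"
        using N(1) \<open>T > 0\<close> by (simp_all add: r_def power_divide power_mult_distrib)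
      define a where "a n = complex_of_real r * (m n * cnj (s n))" for n
      have "(\<Sum>n\<in>B k. norm (a n))\<^sup>2 \<le> r\<^sup>2 * (N * (\<Sum>n\<in>B k. (cmod (s n))\<^sup>2))" for k
      proof -
        have "(\<Sum>n\<in>B k. norm (a n))\<^sup>2 = r\<^sup>2 * (\<Sum>n\<in>B k. cmod (m n) * cmod (s n))\<^sup>2"
          using r(1) by (simp add: a_def norm_mult sum_distrib_left[symmetric] power_mult_distrib)
        also have "\<dots> \<le> r\<^sup>2 * ((\<Sum>n\<in>B k. (cmod (m n))\<^sup>2) * (\<Sum>n\<in>B k. (cmod (s n))\<^sup>2))"
          by (intro mult_left_mono Cauchy_Schwarz_ineq_sum) simp
        also have "\<dots> \<le> r\<^sup>2 * (N * (\<Sum>n\<in>B k. (cmod (s n))\<^sup>2))"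
          by (intro mult_left_mono mult_right_mono N(2) sum_nonneg) auto
        finally show ?thesis .
      qed
      then have "(\<Sum>k\<in>K. (\<Sum>n\<in>B k. norm (a n))\<^sup>2) \<le> (\<Sum>k\<in>K. r\<^sup>2 * (N * (\<Sum>n\<in>B k. (cmod (s n))\<^sup>2)))"
        by (rule sum_mono)
      also have "\<dots> = 1 / 4"
        using r(2) by (simp add: T_def sum_distrib_left)
      finally have "norm (\<Sum>k\<in>K. \<Sum>n\<in>B k. a n * fourier_coeff f n) \<le> C"
        by (rule C(2)[OF K])
      \<comment> \<open>The pairing therefore equals \<open>r * T\<close>. Squaring
        \<open>r * T \<le> C\<close> and inserting the value of \<open>r\<close> leaves
        \<open>T \<le> 4 * N * C\<^sup>2\<close>.\<close>
      moreover have "a n * fourier_coeff f n = complex_of_real (r * (cmod (s n))\<^sup>2)" for n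
        unfolding of_real_mult complex_norm_square by (simp add: a_def s_def mult_ac)
      then have "(\<Sum>k\<in>K. \<Sum>n\<in>B k. a n * fourier_coeff f n) = complex_of_real (r * T)"
        by (simp add: T_def sum_distrib_left)
      ultimately have "r * T \<le> C"
        using r(1) \<open>T > 0\<close> by (simp del: of_real_mult)
      then have "(r * T)\<^sup>2 \<le> C\<^sup>2"
        using r(1) \<open>T > 0\<close> by (intro power_mono) auto
      then have "4 * N * (r\<^sup>2 * T * T) \<le> 4 * N * C\<^sup>2"
        using N(1) by (intro mult_left_mono) (auto simp: power2_eq_square mult_ac)
      moreover have "4 * N * (r\<^sup>2 * T * T) = T"
        using r(2) by (simp add: mult_ac)
      ultimately have "T \<le> 4 * N * C\<^sup>2" by linarith
      then show ?thesis unfolding T_def by (simp only: mult_ac)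
    qed
  qed
  show ?thesis
  proof (rule nonneg_bdd_above_summable_on)
    show "bdd_above (sum (\<lambda>n. (cmod (m n * fourier_coeff f n))\<^sup>2) ` {F. F \<subseteq> (\<Union>k. B k) \<and> finite F})"
    proof (rule bdd_aboveI2)
      fix F assume "F \<in> {F. F \<subseteq> (\<Union>k. B k) \<and> finite F}"
      then obtain K where K: "finite K" "F \<subseteq> (\<Union>k\<in>K. B k)"
        using finite_subset_Union[of F "range B"] by (metis (no_types, lifting) finite_subset_image mem_Collect_eq)
      have "sum (\<lambda>n. (cmod (m n * fourier_coeff f n))\<^sup>2) F \<le> (\<Sum>n\<in>(\<Union>k\<in>K. B k). (cmod (s n))\<^sup>2)"
        unfolding s_def using K B(2) by (intro sum_mono2) auto
      also have "\<dots> = (\<Sum>k\<in>K. \<Sum>n\<in>B k. (cmod (s n))\<^sup>2)"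
        using K B(2) dissociated_disjoint[OF B(1,3)] by (intro sum.UNION_disjoint) auto
      also have "\<dots> \<le> 4 * C\<^sup>2 * N"
        by (rule T[OF K(1)])
      finally show "sum (\<lambda>n. (cmod (m n * fourier_coeff f n))\<^sup>2) F \<le> 4 * C\<^sup>2 * N" .
    qed
  qed simp
qed

section \<open>Analytic test functions and the dyadic estimate for multipliers from H^1\<close>

text \<open>Monotone convergence makes the series absolutely convergent almost everywhere.
  Characters have modulus 1, so the twisted series has the same norms and may be integrated term by
  term.\<close>

lemma
  assumes u: "\<And>k. integrable torus (u k)" and sum: "summable (\<lambda>k. LINT t|torus. cmod (u k t))"
  shows integrable_torus_suminf: "integrable torus (\<lambda>t. \<Sum>k. u k t)"
    and fourier_coeff_suminf: "(\<lambda>k. fourier_coeff (u k) n) sums fourier_coeff (\<lambda>t. \<Sum>k. u k t) n"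
proof -
  have [measurable]: "u k \<in> borel_measurable torus" for k
    using u by simp
  have "(\<integral>\<^sup>+ t. (\<Sum>k. ennreal (cmod (u k t))) \<partial>torus) = (\<Sum>k. \<integral>\<^sup>+ t. ennreal (cmod (u k t)) \<partial>torus)"
    by (rule nn_integral_suminf) measurable
  also have "\<dots> = (\<Sum>k. ennreal (LINT t|torus. cmod (u k t)))"
    by (intro suminf_cong nn_integral_eq_integral integrable_norm u) auto
  also have "\<dots> \<noteq> \<infinity>"
    unfolding infinity_ennreal_def by (rule ennreal_suminf_neq_top[OF sum]) simp
  finally have "AE t in torus. (\<Sum>k. ennreal (cmod (u k t))) \<noteq> \<infinity>"
    by (intro nn_integral_PInf_AE) measurable
  then have AE: "AE t in torus. summable (\<lambda>k. cmod (u k t))"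
    by eventually_elim (auto intro: summable_suminf_not_top)
  show int: "integrable torus (\<lambda>t. \<Sum>k. u k t)"
    by (rule integrable_suminf[OF u AE sum])
  let ?e = "\<lambda>t. cis (- (of_int n * t))"
  have "continuous_on UNIV ?e"
    by (intro continuous_intros)
  note e = this borel_measurable_torus_continuous[OF this]
  have "(\<lambda>k. LINT t|torus. u k t * ?e t) sums (LINT t|torus. (\<Sum>k. u k t * ?e t))"
    by (rule sums_integral)
       (use AE sum in \<open>simp_all add: norm_mult integrable_mult_continuous_torus u e(1)\<close>)
  also have "(LINT t|torus. (\<Sum>k. u k t * ?e t)) = (LINT t|torus. (\<Sum>k. u k t) * ?e t)"
  proof (rule integral_cong_AE)
    show "AE t in torus. (\<Sum>k. u k t * ?e t) = (\<Sum>k. u k t) * ?e t"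
      using AE by eventually_elim (metis suminf_mult2 summable_norm_cancel)
    show "(\<lambda>t. \<Sum>k. u k t * ?e t) \<in> borel_measurable torus"
      using e(2) by measurable
    show "(\<lambda>t. (\<Sum>k. u k t) * ?e t) \<in> borel_measurable torus"
      using e(2) by measurable
  qed
  finally show "(\<lambda>k. fourier_coeff (u k) n) sums fourier_coeff (\<lambda>t. \<Sum>k. u k t) n"
    unfolding fourier_coeff_def by (rule sums_divide)
qed

lemma fourier_coeff_cmult: "fourier_coeff (\<lambda>t. a * f t) n = a * fourier_coeff f n"
  by (simp add: fourier_coeff_def mult.assoc)

lemma fourier_coeff_sum_cis:
  assumes "finite X"
  shows "fourier_coeff (\<lambda>t. \<Sum>x\<in>X. cis (of_int (p x) * t)) n = of_nat (card {x\<in>X. p x = n})"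
proof -
  have "(LINT t|torus. (\<Sum>x\<in>X. cis (of_int (p x) * t)) * cis (- (of_int n * t)))
      = (LINT t|torus. (\<Sum>x\<in>X. cis (of_int (p x - n) * t)))"
    unfolding sum_distrib_right cis_mult by (simp add: left_diff_distrib)
  also have "\<dots> = (\<Sum>x\<in>X. LINT t|torus. cis (of_int (p x - n) * t))"
    by (intro Bochner_Integration.integral_sum integrable_torus_continuous continuous_intros)
  also have "\<dots> = (\<Sum>x\<in>X. if p x = n then 2 * pi else 0)"
    by (simp add: integral_cis_torus del: of_int_diff)
  also have "\<dots> = 2 * pi * of_nat (card {x\<in>X. p x = n})"
    using assms by (simp add: sum.If_cases Int_def)
  finally show ?thesis
    by (simp add: fourier_coeff_def)
qed

text \<open>For \<open>s = 1\<close> this is \<open>exp(it) D(t)\<^sup>2 / N\<close> with \<open>D = \<Sum>j<N. exp(ijt)\<close>: an analytic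
  polynomial with the modulus of the Fejer kernel, hence bounded in \<open>L\<^sup>1\<close> by Parseval.\<close>

definition hardy_kernel :: "int \<Rightarrow> nat \<Rightarrow> real \<Rightarrow> complex" where
  "hardy_kernel s N t =
     (\<Sum>(j, l)\<in>{..<N} \<times> {..<N}. cis (of_int (s * (1 + int j + int l)) * t)) / of_nat N"

text \<open>For \<open>\<bar>s\<bar> = 1\<close> and \<open>N > 0\<close> this is a triangle in
  \<open>s * n\<close>, supported between 1 and \<open>2 * N - 1\<close> with peak 1 at
  \<open>N\<close>.\<close>

definition hardy_coeff :: "int \<Rightarrow> nat \<Rightarrow> int \<Rightarrow> real" where
  "hardy_coeff s N n =
     real (card {(j, l). j < N \<and> l < N \<and> s * (1 + int j + int l) = n}) / real N"

lemma hardy_coeff_nonneg: "hardy_coeff s N n \<ge> 0"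
  by (simp add: hardy_coeff_def)

lemma fourier_coeff_hardy_kernel:
  "fourier_coeff (hardy_kernel s N) n = of_real (hardy_coeff s N n)"
proof -
  have "hardy_kernel s N = (\<lambda>t. 1 / of_nat N *
      (\<Sum>x\<in>{..<N} \<times> {..<N}. cis (of_int (s * (1 + int (fst x) + int (snd x))) * t)))"
    by (simp add: hardy_kernel_def case_prod_beta fun_eq_iff)
  then have "fourier_coeff (hardy_kernel s N) n = 1 / of_nat N *
      of_nat (card {x\<in>{..<N} \<times> {..<N}. s * (1 + int (fst x) + int (snd x)) = n})"
    by (simp only: fourier_coeff_cmult fourier_coeff_sum_cis finite_cartesian_product finite_lessThan)
  also have "{x\<in>{..<N} \<times> {..<N}. s * (1 + int (fst x) + int (snd x)) = n}
      = {(j, l). j < N \<and> l < N \<and> s * (1 + int j + int l) = n}"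
    by auto
  finally show ?thesis by (simp add: hardy_coeff_def)
qed

text \<open>The spectrum lies strictly on the side of \<open>s\<close>, because
  \<open>s * s = 1\<close>. On such a spectrum the Hilbert transform is multiplication by a
  constant.\<close>

lemma hardy_coeff_eq_0:
  assumes "\<bar>s\<bar> = 1" "s * n \<le> 0"
  shows "hardy_coeff s N n = 0"
proof -
  have "s * (s * (1 + int j + int l)) > 0" for j l
    using assms(1) by (auto simp: abs_if split: if_splits)
  then have "s * (1 + int j + int l) \<noteq> n" for j l
    using assms(2) by (metis not_less)
  then have *: "{(j, l). j < N \<and> l < N \<and> s * (1 + int j + int l) = n} = {}"
    by simp
  show ?thesis unfolding hardy_coeff_def * by simp
qed

text \<open>On the rising side of the triangle the \<open>n\<close> pairs
  \<open>(j, n - 1 - j)\<close> are all admissible.\<close>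

lemma hardy_coeff_ge:
  assumes "n \<le> N"
  shows "hardy_coeff s N (s * int n) \<ge> real n / real N"
proof -
  let ?P = "{(j, l). j < N \<and> l < N \<and> s * (1 + int j + int l) = s * int n}"
  have "(\<lambda>j. (j, n - 1 - j)) ` {..<n} \<subseteq> ?P"
    using assms by auto
  moreover have "finite ?P"
    by (rule finite_subset[of _ "{..<N} \<times> {..<N}"]) auto
  ultimately have "card ((\<lambda>j. (j, n - 1 - j)) ` {..<n}) \<le> card ?P"
    by (intro card_mono)
  then have "n \<le> card ?P"
    by (subst (asm) card_image) (auto simp: inj_on_def)
  then show ?thesis
    unfolding hardy_coeff_def by (intro divide_right_mono) auto
qed

lemma continuous_on_hardy_kernel [continuous_intros]: "continuous_on X (hardy_kernel s N)"
  unfolding hardy_kernel_def case_prod_beta divide_inverse by (intro continuous_intros)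

lemma integral_norm_hardy_kernel:
  assumes "\<bar>s\<bar> = 1" "N > 0"
  shows "(LINT t|torus. cmod (hardy_kernel s N t)) = 2 * pi"
proof -
  define D where "D t = (\<Sum>j<N. cis (of_int (s * int j) * t))" for t
  have "D t * D t = (\<Sum>x\<in>{..<N} \<times> {..<N}.
      cis (of_int (s * int (fst x)) * t) * cis (of_int (s * int (snd x)) * t))" for t
    unfolding D_def sum_product sum.cartesian_product case_prod_beta ..
  then have "hardy_kernel s N t = cis (of_int s * t) * (D t * D t) / of_nat N" for t
    by (simp add: hardy_kernel_def sum_distrib_left case_prod_beta cis_mult distrib_left
        distrib_right add.assoc)
  then have "complex_of_real (cmod (hardy_kernel s N t)) = 1 / of_nat N * (D t * cnj (D t))" for t
    by (simp add: norm_mult norm_divide flip: complex_norm_square) (simp add: power2_eq_square)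
  also have "1 / of_nat N * (D t * cnj (D t))
      = 1 / of_nat N * (\<Sum>(j, l)\<in>{..<N} \<times> {..<N}. cis (of_int (s * (int j - int l)) * t))" for t
    unfolding D_def cnj_sum sum_product sum.cartesian_product
    by (simp add: cis_cnj cis_mult algebra_simps)
  finally have "complex_of_real (LINT t|torus. cmod (hardy_kernel s N t))
      = (LINT t|torus. 1 / of_nat N * (\<Sum>(j, l)\<in>{..<N} \<times> {..<N}. cis (of_int (s * (int j - int l)) * t)))"
    by (simp flip: integral_complex_of_real)
  also have "\<dots> = 1 / of_nat N *
      (LINT t|torus. (\<Sum>x\<in>{..<N} \<times> {..<N}. cis (of_int (s * (int (fst x) - int (snd x))) * t)))"
    by (simp add: case_prod_beta)
  also have "\<dots> = 1 / of_nat N *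
      (\<Sum>x\<in>{..<N} \<times> {..<N}. LINT t|torus. cis (of_int (s * (int (fst x) - int (snd x))) * t))"
    by (subst Bochner_Integration.integral_sum)
       (intro integrable_torus_continuous continuous_intros, simp)
  also have "\<dots> = 1 / of_nat N * (\<Sum>x\<in>{..<N} \<times> {..<N}. if fst x = snd x then complex_of_real (2 * pi) else 0)"
    unfolding integral_cis_torus using assms(1)
    by (intro arg_cong2[where f = "(*)"] sum.cong refl) auto
  also have "\<dots> = 1 / of_nat N * (\<Sum>j<N. \<Sum>l<N. if j = l then complex_of_real (2 * pi) else 0)"
    by (simp only: sum.cartesian_product) (simp add: case_prod_beta)
  also have "\<dots> = complex_of_real (2 * pi)"
    using assms(2) by simp
  finally show ?thesis
    unfolding of_real_eq_iff .
qed

text \<open>Gliding hump. The coefficients of the test polynomials are nonnegative, so the humps cannot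
  cancel and no uniform boundedness principle is needed.\<close>

lemma H1_multiplier_dyadic_half:
  assumes m: "m \<in> multipliers_to_L2 H1_torus" and s: "\<bar>s\<bar> = 1"
  shows "\<exists>M. \<forall>k. (\<Sum>n\<in>{2^k..<2^(k+1)}. (cmod (m (s * int n)))\<^sup>2) \<le> M"
proof (rule ccontr)
  define S where "S k = (\<Sum>n\<in>{2^k..<2^(k+1)}. (cmod (m (s * int n)))\<^sup>2)" for k
  assume "\<not> ?thesis"
  \<comment> \<open>The factor \<open>4 ^ j\<close> will absorb the squared weight
    \<open>(1/2) ^ j\<close> of the \<open>j\<close>-th hump, and the factor 4 the squared lower
    bound 1/2 of the kernel coefficients.\<close>
  then have "\<exists>k. S k > 4 * 4 ^ j * real j" for j
    unfolding S_def by (meson not_le)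
  then obtain \<kappa> where \<kappa>: "\<And>j. S (\<kappa> j) > 4 * 4 ^ j * real j"
    by metis
  \<comment> \<open>The length \<open>2 ^ (\<kappa> j + 1)\<close> places the chosen block where the
    triangle is at least 1/2. The weights make the series converge in the norm of L^1.\<close>
  define u where "u j t = complex_of_real ((1/2) ^ j) * hardy_kernel s (2 ^ (\<kappa> j + 1)) t" for j t
  define f where "f t = (\<Sum>j. u j t)" for t
  have u: "integrable torus (u j)" for j
    unfolding u_def by (intro integrable_torus_continuous continuous_intros)
  have "(LINT t|torus. cmod (u j t)) = 2 * pi * (1/2) ^ j" for j
    using integral_norm_hardy_kernel[OF s, of "2 ^ (\<kappa> j + 1)"]
    by (simp add: u_def norm_mult norm_power)
  then have sum: "summable (\<lambda>j. LINT t|torus. cmod (u j t))"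
    by (simp add: summable_mult summable_geometric)
  have fL1: "integrable torus f"
    unfolding f_def by (rule integrable_torus_suminf[OF u sum])
  have "(\<lambda>j. complex_of_real ((1/2) ^ j * hardy_coeff s (2 ^ (\<kappa> j + 1)) n)) sums fourier_coeff f n" for n
    using fourier_coeff_suminf[OF u sum, of n]
    unfolding f_def u_def fourier_coeff_cmult fourier_coeff_hardy_kernel of_real_mult .
  note coeff = this sums_Re[OF this, unfolded Re_complex_of_real]
  have zero: "fourier_coeff f n = 0" if "s * n \<le> 0" for n
    using coeff(1)[of n] that sums_unique2[OF _ sums_zero] by (simp add: hardy_coeff_eq_0[OF s])
  \<comment> \<open>Where the coefficient of \<open>f\<close> is nonzero, \<open>sgn n = s\<close>,
    so the transform is a multiple of \<open>f\<close> itself.\<close>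
  have "has_hilbert_transform f (\<lambda>t. - \<i> * of_int s * f t)"
    unfolding has_hilbert_transform_def L1_torus_def fourier_coeff_cmult mem_Collect_eq
  proof (intro conjI allI fL1 integrable_mult_right)
    fix n
    show "- \<i> * of_int s * fourier_coeff f n = - \<i> * of_int (sgn n) * fourier_coeff f n"
    proof (cases "s * n \<le> 0")
      case False
      then have "sgn n = s" using s by (auto simp: abs_if sgn_if split: if_splits)
      then show ?thesis by simp
    qed (simp add: zero)
  qed
  then have "f \<in> H1_torus"
    unfolding H1_torus_def has_hilbert_transform_def by blast
  then have summ: "(\<lambda>n. (cmod (m n * fourier_coeff f n))\<^sup>2) summable_on UNIV"
    using m by (simp add: multipliers_to_L2_def)
  define A where "A = infsum (\<lambda>n. (cmod (m n * fourier_coeff f n))\<^sup>2) UNIV"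
  have "real j < A" for j
  proof -
    let ?I = "{2 ^ \<kappa> j..<2 ^ (\<kappa> j + 1)} :: nat set"
    have ge: "(1/2) ^ j / 2 \<le> cmod (fourier_coeff f (s * int n))" if "n \<in> ?I" for n
    proof -
      let ?N = "2 ^ (\<kappa> j + 1) :: nat"
      have "1 / 2 \<le> real n / real ?N"
        using that by (simp add: field_simps)
      also have "\<dots> \<le> hardy_coeff s ?N (s * int n)"
        using that by (intro hardy_coeff_ge) auto
      finally have "(1/2) ^ j * (1 / 2) \<le> (1/2) ^ j * hardy_coeff s ?N (s * int n)"
        by (intro mult_left_mono) auto
      also have "\<dots> \<le> Re (fourier_coeff f (s * int n))"
        using coeff(2)[of "s * int n"]
          sum_le_suminf[of "\<lambda>i. (1/2) ^ i * hardy_coeff s (2 ^ (\<kappa> i + 1)) (s * int n)" "{j}"]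
        by (simp add: sums_iff hardy_coeff_nonneg)
      also have "\<dots> \<le> cmod (fourier_coeff f (s * int n))"
        by (rule complex_Re_le_cmod)
      finally show ?thesis by simp
    qed
    have "((1/2) ^ j / 2)\<^sup>2 = 1 / (4 * 4 ^ j :: real)"
      by (simp add: power_divide power2_eq_square flip: power_mult_distrib)
    then have "real j < S (\<kappa> j) * ((1/2) ^ j / 2)\<^sup>2"
      using \<kappa>[of j] by (simp add: field_simps)
    also have "\<dots> = (\<Sum>n\<in>?I. (cmod (m (s * int n)))\<^sup>2 * ((1/2) ^ j / 2)\<^sup>2)"
      unfolding S_def sum_distrib_right ..
    also have "\<dots> \<le> (\<Sum>n\<in>?I. (cmod (m (s * int n) * fourier_coeff f (s * int n)))\<^sup>2)"
      unfolding norm_mult power_mult_distrib using ge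
      by (intro sum_mono mult_left_mono power_mono) auto
    also have "\<dots> = (\<Sum>n\<in>(\<lambda>n. s * int n) ` ?I. (cmod (m n * fourier_coeff f n))\<^sup>2)"
      using s by (subst sum.reindex) (auto simp: inj_on_def)
    also have "\<dots> \<le> A"
      unfolding A_def by (intro finite_sum_le_infsum summ) auto
    finally show ?thesis .
  qed
  then show False
    using reals_Archimedean2[of A] by (meson less_asym)
qed

section \<open>Dyadic blocks and the inclusion\<close>

definition dyadic_block :: "nat \<Rightarrow> int set" where
  "dyadic_block k = {n. 2 ^ k \<le> \<bar>n\<bar> \<and> \<bar>n\<bar> < 2 ^ (k + 1)}"

lemma uminus_dyadic_block: "uminus ` dyadic_block k = dyadic_block k"
proof -
  have "n \<in> uminus ` dyadic_block k" if "n \<in> dyadic_block k" for n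
    using that by (intro image_eqI[of _ _ "- n"]) (auto simp: dyadic_block_def)
  then show ?thesis by (auto simp: dyadic_block_def)
qed

lemma dyadic_block_eq:
  "dyadic_block k = (\<lambda>n. 1 * int n) ` {2^k..<2^(k+1)} \<union> (\<lambda>n. - 1 * int n) ` {2^k..<2^(k+1)}"
proof (intro equalityI subsetI)
  fix n assume n: "n \<in> dyadic_block k"
  have "2 ^ k \<le> nat \<bar>n\<bar>" "nat \<bar>n\<bar> < 2 ^ (k + 1)"
    using n by (simp_all add: dyadic_block_def le_nat_iff nat_less_iff)
  then have "nat \<bar>n\<bar> \<in> {2^k..<2^(k+1)}"
    by simp
  moreover have "n = 1 * int (nat \<bar>n\<bar>) \<or> n = - 1 * int (nat \<bar>n\<bar>)"
    by linarith
  ultimately show "n \<in> (\<lambda>n. 1 * int n) ` {2^k..<2^(k+1)} \<union> (\<lambda>n. - 1 * int n) ` {2^k..<2^(k+1)}"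
    by blast
next
  fix n assume "n \<in> (\<lambda>n. 1 * int n) ` {2^k..<2^(k+1)} \<union> (\<lambda>n. - 1 * int n) ` {2^k..<2^(k+1)}"
  then obtain i :: nat where i: "2 ^ k \<le> i" "i < 2 ^ (k + 1)" "\<bar>n\<bar> = int i"
    by auto
  then have "int (2 ^ k) \<le> \<bar>n\<bar>" "\<bar>n\<bar> < int (2 ^ (k + 1))"
    unfolding i(3) of_nat_le_iff of_nat_less_iff by simp_all
  then show "n \<in> dyadic_block k"
    by (simp add: dyadic_block_def)
qed

lemma finite_dyadic_block: "finite (dyadic_block k)"
  unfolding dyadic_block_eq by simp

lemma UN_dyadic_blocks:
  "UNIV = {0} \<union> (\<Union>k. dyadic_block (2 * k)) \<union> (\<Union>k. dyadic_block (2 * k + 1))"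
proof -
  have "n \<in> {0} \<union> (\<Union>k. dyadic_block (2 * k)) \<union> (\<Union>k. dyadic_block (2 * k + 1))" for n
  proof (cases "n = 0")
    case False
    define q where "q = floor_log (nat \<bar>n\<bar>)"
    have "2 ^ q \<le> nat \<bar>n\<bar>"
      using False unfolding q_def by (intro floor_log_exp2_le) simp
    moreover have "nat \<bar>n\<bar> < 2 * 2 ^ q"
      unfolding q_def by (rule floor_log_exp2_gt)
    ultimately have "n \<in> dyadic_block q"
      by (simp add: dyadic_block_def le_nat_iff nat_less_iff)
    moreover obtain k where "q = 2 * k \<or> q = 2 * k + 1"
      by (metis evenE oddE)
    ultimately show ?thesis by blast
  qed simp
  then show ?thesis by blast
qed

text \<open>In every second dyadic block the frequency of the largest block exceeds the sum of all the
  others.\<close>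

lemma dissociated_dyadic_blocks: "dissociated (\<lambda>k. dyadic_block (2 * k + e))"
  unfolding dissociated_def
proof (intro allI impI)
  fix S :: "nat set" and \<nu> :: "nat \<Rightarrow> int"
  assume S: "finite S \<and> S \<noteq> {} \<and> (\<forall>k\<in>S. \<nu> k \<in> dyadic_block (2 * k + e))"
  define K where "K = Max S"
  have K: "K \<in> S" "\<And>k. k \<in> S \<Longrightarrow> k \<le> K"
    using S by (auto simp: K_def)
  \<comment> \<open>Skipping every second block is essential: lower ends grow by the factor 4, so
    the upper ends of all smaller blocks together stay below the next lower end.\<close>
  have geom: "(\<Sum>k<K. 2 ^ (2 * k + e + 1)) < (2 ^ (2 * K + e) :: int)" for K
  proof (induction K)
    case (Suc K)
    have "2 ^ (2 * K + e + 1) = 2 * (2 ^ (2 * K + e) :: int)"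
      "2 ^ (2 * Suc K + e) = 4 * (2 ^ (2 * K + e) :: int)"
      by simp_all
    moreover have "0 < (2 ^ (2 * K + e) :: int)" by simp
    ultimately show ?case using Suc by (simp only: sum.lessThan_Suc)
  qed simp
  have "\<bar>\<Sum>k\<in>S - {K}. \<nu> k\<bar> \<le> (\<Sum>k\<in>S - {K}. \<bar>\<nu> k\<bar>)"
    by (rule sum_abs)
  also have "\<dots> \<le> (\<Sum>k\<in>S - {K}. 2 ^ (2 * k + e + 1))"
    using S by (intro sum_mono) (auto simp: dyadic_block_def intro: less_imp_le)
  also have "\<dots> \<le> (\<Sum>k<K. 2 ^ (2 * k + e + 1))"
    using K by (intro sum_mono2) (auto simp: less_le)
  also note geom
  also have "2 ^ (2 * K + e) \<le> \<bar>\<nu> K\<bar>"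
    using S K(1) by (auto simp: dyadic_block_def)
  finally show "(\<Sum>k\<in>S. \<nu> k) \<noteq> 0"
    using S K(1) by (simp add: sum.remove)
qed

lemma H1_multiplier_dyadic:
  assumes m: "m \<in> multipliers_to_L2 H1_torus"
  shows "\<exists>M. \<forall>k. (\<Sum>n\<in>dyadic_block k. (cmod (m n))\<^sup>2) \<le> M"
proof -
  let ?I = "\<lambda>k. {2^k..<2^(k+1)} :: nat set"
  obtain M1 where M1: "\<And>k. (\<Sum>n\<in>?I k. (cmod (m (1 * int n)))\<^sup>2) \<le> M1"
    using H1_multiplier_dyadic_half[OF m, of 1] by auto
  obtain M2 where M2: "\<And>k. (\<Sum>n\<in>?I k. (cmod (m (- 1 * int n)))\<^sup>2) \<le> M2"
    using H1_multiplier_dyadic_half[OF m, of "- 1"] by auto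
  have "(\<Sum>n\<in>dyadic_block k. (cmod (m n))\<^sup>2) \<le> M1 + M2" for k
  proof -
    have "(\<Sum>n\<in>dyadic_block k. (cmod (m n))\<^sup>2)
        \<le> (\<Sum>n\<in>(\<lambda>n. 1 * int n) ` ?I k. (cmod (m n))\<^sup>2) + (\<Sum>n\<in>(\<lambda>n. - 1 * int n) ` ?I k. (cmod (m n))\<^sup>2)"
      unfolding dyadic_block_eq by (subst sum_Un) (auto intro: sum_nonneg)
    also have "\<dots> = (\<Sum>n\<in>?I k. (cmod (m (1 * int n)))\<^sup>2) + (\<Sum>n\<in>?I k. (cmod (m (- 1 * int n)))\<^sup>2)"
      by (subst (1 2) sum.reindex) (auto simp: inj_on_def)
    also have "\<dots> \<le> M1 + M2"
      by (intro add_mono M1 M2)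
    finally show ?thesis .
  qed
  then show ?thesis by blast
qed

text \<open>Blocks of even and of odd index are treated separately, since all dyadic blocks together
  are not dissociated: \<open>1 + 3 - 4 = 0\<close>. The frequency 0 adds a single term.\<close>

lemma H1_multipliers_subset_L_log_L:
  "multipliers_to_L2 H1_torus \<subseteq> multipliers_to_L2 (L_log_L_torus (1/2))"
proof
  fix m assume m: "m \<in> multipliers_to_L2 H1_torus"
  obtain M where M: "\<And>k. (\<Sum>n\<in>dyadic_block k. (cmod (m n))\<^sup>2) \<le> M"
    using H1_multiplier_dyadic[OF m] by blast
  have "(\<lambda>n. (cmod (m n * fourier_coeff f n))\<^sup>2) summable_on UNIV"
    if f: "f \<in> L_log_L_torus (1/2)" for f
  proof -
    have "(\<lambda>n. (cmod (m n * fourier_coeff f n))\<^sup>2) summable_on (\<Union>k. dyadic_block (2 * k + e))" for e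
      by (rule dissociated_multiplier[OF dissociated_dyadic_blocks finite_dyadic_block
            uminus_dyadic_block M f])
    from this[of 0] this[of 1] show ?thesis
      unfolding UN_dyadic_blocks by (intro summable_on_union) auto
  qed
  with m show "m \<in> multipliers_to_L2 (L_log_L_torus (1/2))"
    by (simp add: multipliers_to_L2_def)
qed

section \<open>Properness: integers with distinct 2-adic valuations\<close>

text \<open>The exponent \<open>2 ^ (floor_log i + 1)\<close> exceeds \<open>i\<close>, so that \<open>i\<close> is the 2-adic valuation of
  this integer. It is the same for all \<open>i\<close> in a dyadic interval, so that arbitrarily many of these
  integers fall into a single dyadic block.\<close>

definition crowded :: "nat \<Rightarrow> nat" where
  "crowded i = 2 ^ i + 2 ^ (2 ^ (floor_log i + 1))"

lemma crowded_valuation: "2 ^ i dvd int (crowded i)" "\<not> 2 ^ Suc i dvd int (crowded i)"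
proof -
  have "i < 2 ^ (floor_log i + 1)"
    using floor_log_exp2_gt[of i] by simp
  then have "Suc i \<le> 2 ^ (floor_log i + 1)" by simp
  then have *: "(2::int) ^ Suc i dvd 2 ^ (2 ^ (floor_log i + 1))"
    by (rule le_imp_power_dvd)
  have eq: "int (crowded i) = 2 ^ i + 2 ^ (2 ^ (floor_log i + 1))"
    by (simp add: crowded_def)
  show "2 ^ i dvd int (crowded i)"
    unfolding eq using * by (intro dvd_add) (auto intro: dvd_trans[OF le_imp_power_dvd])
  have "\<not> (2::int) ^ Suc i dvd 2 ^ i"
    by (simp add: power_dvd_imp_le[of 2 "Suc i" i])
  then show "\<not> 2 ^ Suc i dvd int (crowded i)"
    unfolding eq using * by (simp add: dvd_add_left_iff del: power_Suc)
qed

text \<open>In a vanishing sum the term of smallest index \<open>j\<close> would be minus the sum of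
  the others, which is divisible by \<open>2 ^ Suc j\<close>, whereas its own valuation is only
  \<open>j\<close>.\<close>

lemma dissociated_crowded: "dissociated (\<lambda>i. {int (crowded i), - int (crowded i)})"
  unfolding dissociated_def
proof (intro allI impI notI)
  fix S and \<nu> :: "nat \<Rightarrow> int"
  assume S: "finite S \<and> S \<noteq> {} \<and> (\<forall>i\<in>S. \<nu> i \<in> {int (crowded i), - int (crowded i)})"
    and sum: "(\<Sum>i\<in>S. \<nu> i) = 0"
  define j where "j = Min S"
  have j: "j \<in> S" "\<And>i. i \<in> S \<Longrightarrow> j \<le> i"
    using S by (auto simp: j_def)
  have "2 ^ Suc j dvd \<nu> i" if "i \<in> S - {j}" for i
  proof -
    have "Suc j \<le> i" using that j(2)[of i] by auto
    then have "(2::int) ^ Suc j dvd int (crowded i)"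
      by (rule dvd_trans[OF le_imp_power_dvd crowded_valuation(1)])
    then show ?thesis using S that by auto
  qed
  then have "2 ^ Suc j dvd (\<Sum>i\<in>S - {j}. \<nu> i)"
    by (rule dvd_sum)
  moreover have "(\<Sum>i\<in>S - {j}. \<nu> i) = - \<nu> j"
    using S j(1) sum by (simp add: sum.remove)
  ultimately have "2 ^ Suc j dvd int (crowded j)"
    using S j(1) by auto
  then show False using crowded_valuation(2) by blast
qed

definition crowded_multiplier :: "int \<Rightarrow> complex" where
  "crowded_multiplier = indicator (range (\<lambda>i. int (crowded i)))"

lemma norm_crowded_multiplier_le: "cmod (crowded_multiplier n) \<le> 1"
  by (simp add: crowded_multiplier_def indicator_def)

lemma crowded_multiplier_L_log_L:
  "crowded_multiplier \<in> multipliers_to_L2 (L_log_L_torus (1/2))"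
proof -
  let ?m = crowded_multiplier
  let ?B = "\<lambda>i. {int (crowded i), - int (crowded i)}"
  have "(\<lambda>n. (cmod (?m n * fourier_coeff f n))\<^sup>2) summable_on UNIV"
    if f: "f \<in> L_log_L_torus (1/2)" for f
  proof -
    have "(\<Sum>n\<in>?B i. (cmod (?m n))\<^sup>2) \<le> 2" for i
    proof -
      have "(\<Sum>n\<in>?B i. (cmod (?m n))\<^sup>2) \<le> (\<Sum>n\<in>?B i. 1)"
        using norm_crowded_multiplier_le by (intro sum_mono power_le_one) auto
      also have "\<dots> \<le> 2" by (simp add: card_insert_if)
      finally show ?thesis .
    qed
    then have "(\<lambda>n. (cmod (?m n * fourier_coeff f n))\<^sup>2) summable_on (\<Union>i. ?B i)"
      by (intro dissociated_multiplier[OF dissociated_crowded _ _ _ f]) auto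
    \<comment> \<open>Outside the union of the blocks the multiplier vanishes.\<close>
    then show ?thesis
      by (rule summable_on_cong_neutral[THEN iffD1, rotated -1])
         (auto simp: crowded_multiplier_def indicator_def)
  qed
  moreover have "bounded (range ?m)"
    using norm_crowded_multiplier_le by (intro boundedI[of _ 1]) auto
  ultimately show ?thesis
    by (simp add: multipliers_to_L2_def)
qed

text \<open>All \<open>i\<close> with \<open>2 ^ j \<le> i < 2 ^ (j + 1)\<close> share the large
  exponent \<open>k = 2 ^ (j + 1)\<close>, which exceeds \<open>i\<close>. Thus \<open>2 ^ j\<close>
  distinct numbers \<open>2 ^ i + 2 ^ k\<close> lie between \<open>2 ^ k\<close> and
  \<open>2 ^ (k + 1)\<close>, and the block sums are unbounded.\<close>

lemma crowded_multiplier_not_H1: "crowded_multiplier \<notin> multipliers_to_L2 H1_torus"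
proof
  let ?m = crowded_multiplier
  assume "?m \<in> multipliers_to_L2 H1_torus"
  then obtain M where M: "\<And>k. (\<Sum>n\<in>{2^k..<2^(k+1)}. (cmod (?m (1 * int n)))\<^sup>2) \<le> M"
    using H1_multiplier_dyadic_half[of ?m 1] by auto
  have "2 ^ j \<le> M" for j
  proof -
    define k :: nat where "k = 2 ^ (j + 1)"
    let ?J = "{2 ^ j..<2 ^ (j + 1)} :: nat set"
    have cr: "crowded i = 2 ^ i + 2 ^ k" "i < k" if "i \<in> ?J" for i
    proof -
      have "0 < i" using that by (metis atLeastLessThan_iff less_le_trans zero_less_numeral zero_less_power)
      then have "floor_log i = j"
        using that by (intro floor_log_eqI) auto
      then show "crowded i = 2 ^ i + 2 ^ k" "i < k"
        using that by (auto simp: crowded_def k_def)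
    qed
    have "inj_on crowded ?J"
      by (rule inj_onI) (simp add: cr)
    then have "(2::real) ^ j = (\<Sum>n\<in>crowded ` ?J. 1)"
      by (simp add: card_image)
    also have "\<dots> = (\<Sum>n\<in>crowded ` ?J. (cmod (?m (1 * int n)))\<^sup>2)"
      by (intro sum.cong) (auto simp: crowded_multiplier_def)
    also have "\<dots> \<le> (\<Sum>n\<in>{2^k..<2^(k+1)}. (cmod (?m (1 * int n)))\<^sup>2)"
    proof (intro sum_mono2)
      show "crowded ` ?J \<subseteq> {2^k..<2^(k+1)}"
      proof (rule image_subsetI)
        fix i assume "i \<in> ?J"
        then show "crowded i \<in> {2^k..<2^(k+1)}"
          using cr[of i] by (auto intro: power_strict_increasing)
      qed
    qed auto
    also have "\<dots> \<le> M" by (rule M)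
    finally show ?thesis .
  qed
  moreover obtain j where "M < 2 ^ j"
    using real_arch_pow[of 2 M] by auto
  ultimately show False by (meson not_less)
qed

theorem theorem5:
  "multipliers_to_L2 H1_torus \<subset> multipliers_to_L2 (L_log_L_torus (1/2))"
  using H1_multipliers_subset_L_log_L crowded_multiplier_L_log_L crowded_multiplier_not_H1 by blast

end
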